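(* Let $\Gamma$ be a signed graph and $v$ any one of its vertices, and let $F(\Gamma,v)$ be the Fowler construction for signed graphs. Then the nullities of $\Gamma$ and $F(\Gamma,v)$ are equal, i.e. $\eta(\Gamma)=\eta(F(\Gamma,v))$. Moreover, $\ker A(\Gamma)$ admits a full eigenvector if and only if $\ker A(F(\Gamma,v))$ admits a full eigenvector.
   Context: A signed graph $\Gamma=(G,\sigma)$ is a finite simple graph $G=(V,E)$ with a map $\sigma:E\to\{-1,+1\}$. Its adjacency matrix $A(\Gamma)$ has entry $\sigma(uw)$ for each edge $uw\in E$ and $0$ elsewhere. The nullity is $\eta(\Gamma)=\dim\ker A(\Gamma)$. A vector is full if it has no zero entry. Fowler construction. Let $v$ be a vertex of $G$ of degree $\rho$ with neighbours $u_1,\dots,u_\rho$. The graph $F(G,v)$ has vertex set $V(G)\sqcup\{q_1,\dots,q_\rho\}\sqcup\{p_1,\dots,p_\rho\}$ and edge set $$(E(G)\setminus\{vu_i\mid 1\le i\le\rho\})\cup\{q_ip_j\mid 1\le i,j\le\rho,\ i\ne j\}\cup\{vq_i\mid 1\le i\le\rho\}\cup\{p_iu_i\mid 1\le i\le\rho\}.$$ The signed graph $F(\Gamma,v)=(F(G,v),\sigma')$ has $\sigma'(vq_i)=1$, $\sigma'(q_ip_j)=1$, $\sigma'(p_iu_i)=\sigma(vu_i)$, and $\sigma'(e)=\sigma(e)$ for all other edges $e$. *)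

theory Defs
  imports "HOL-Analysis.Analysis" "HOL-Analysis.Finite_Function_Topology"
begin

record 'a sgraph =
  verts :: "'a set"
  edges :: "'a set set"
  sign :: "'a set \<Rightarrow> real"

text \<open>Only the values of \<^term>\<open>sign \<Gamma>\<close> on \<^term>\<open>edges \<Gamma>\<close> are meaningful.\<close>

definition signed_graph :: "'a sgraph \<Rightarrow> bool" where
  "signed_graph \<Gamma> \<longleftrightarrow>
     finite (verts \<Gamma>) \<and>
     (\<forall>e \<in> edges \<Gamma>. e \<subseteq> verts \<Gamma> \<and> card e = 2) \<and>
     (\<forall>e \<in> edges \<Gamma>. sign \<Gamma> e \<in> {-1, 1})"

definition neighbours :: "'a sgraph \<Rightarrow> 'a \<Rightarrow> 'a set" where
  "neighbours \<Gamma> v = {w. {v, w} \<in> edges \<Gamma>}"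

definition vdegree :: "'a sgraph \<Rightarrow> 'a \<Rightarrow> nat" where
  "vdegree \<Gamma> v = card (neighbours \<Gamma> v)"

definition adjacency :: "'a sgraph \<Rightarrow> 'a \<Rightarrow> 'a \<Rightarrow> real" where
  "adjacency \<Gamma> a b = (if {a, b} \<in> edges \<Gamma> then sign \<Gamma> {a, b} else 0)"

text \<open>Vectors indexed by the vertex set \<open>V\<close> are finitely supported functions with support
  inside \<open>V\<close>; as \<open>V\<close> is finite, these form a copy of the space of all real functions on \<open>V\<close>,
  inside a type that is an instance of \<^class>\<open>real_vector\<close>.\<close>

definition adj_kernel :: "'a sgraph \<Rightarrow> ('a \<Rightarrow>\<^sub>0 real) set" where
  "adj_kernel \<Gamma> =
     {x. Poly_Mapping.keys x \<subseteq> verts \<Gamma> \<and>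
         (\<forall>a \<in> verts \<Gamma>. (\<Sum>b \<in> verts \<Gamma>. adjacency \<Gamma> a b * Poly_Mapping.lookup x b) = 0)}"

lemma subspace_adj_kernel: "subspace (adj_kernel \<Gamma>)"
proof -
  have scale: "Poly_Mapping.lookup (c *\<^sub>R x) b = c * Poly_Mapping.lookup x b"
    for c :: real and x :: "'a \<Rightarrow>\<^sub>0 real" and b
  proof -
    have "finite {i. c * Poly_Mapping.lookup x i \<noteq> 0}"
      by (rule finite_subset[OF _ finite_keys[of x]]) (auto simp: in_keys_iff)
    then show ?thesis by (simp add: scaleR_poly_mapping_def)
  qed
  have sc: "(\<Sum>b \<in> verts \<Gamma>. adjacency \<Gamma> a b * (c * Poly_Mapping.lookup x b)) =
      c * (\<Sum>b \<in> verts \<Gamma>. adjacency \<Gamma> a b * Poly_Mapping.lookup x b)" for a c x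
    by (simp add: sum_distrib_left mult.left_commute)
  have ks: "Poly_Mapping.keys (c *\<^sub>R x) \<subseteq> Poly_Mapping.keys x" for c :: real and x :: "'a \<Rightarrow>\<^sub>0 real"
    by (auto simp: in_keys_iff scale)
  have ka: "Poly_Mapping.keys (x + y) \<subseteq> verts \<Gamma>"
    if "Poly_Mapping.keys x \<subseteq> verts \<Gamma>" "Poly_Mapping.keys y \<subseteq> verts \<Gamma>"
    for x y :: "'a \<Rightarrow>\<^sub>0 real"
    using that Poly_Mapping.keys_add[of x y] by blast
  have ks': "Poly_Mapping.keys (c *\<^sub>R x) \<subseteq> verts \<Gamma>"
    if "Poly_Mapping.keys x \<subseteq> verts \<Gamma>" for c :: real and x :: "'a \<Rightarrow>\<^sub>0 real"
    using ks that by (rule subset_trans)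
  show ?thesis
    unfolding subspace_def adj_kernel_def
    by (simp add: ka ks' lookup_add scale sc distrib_left sum.distrib)
qed

definition nullity :: "'a sgraph \<Rightarrow> nat" where
  "nullity \<Gamma> = dim (adj_kernel \<Gamma>)"

definition full :: "'a sgraph \<Rightarrow> ('a \<Rightarrow>\<^sub>0 real) \<Rightarrow> bool" where
  "full \<Gamma> x \<longleftrightarrow> (\<forall>a \<in> verts \<Gamma>. Poly_Mapping.lookup x a \<noteq> 0)"

definition kernel_has_full_eigenvector :: "'a sgraph \<Rightarrow> bool" where
  "kernel_has_full_eigenvector \<Gamma> \<longleftrightarrow> (\<exists>x \<in> adj_kernel \<Gamma>. x \<noteq> 0 \<and> full \<Gamma> x)"

datatype 'a fowler_vertex = Old 'a | Q nat | P nat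

text \<open>\<open>fowler_origin v\<close> sends the edge \<open>p\<^sub>i u\<^sub>i\<close> of the construction to the edge \<open>v u\<^sub>i\<close> it replaces,
  and each surviving old edge to itself. Edges containing some \<open>q\<^sub>i\<close> are treated
  separately, so the value on \<open>Q i\<close> is irrelevant.\<close>

fun fowler_origin :: "'a \<Rightarrow> 'a fowler_vertex \<Rightarrow> 'a" where
  "fowler_origin v (Old w) = w"
| "fowler_origin v (P i) = v"
| "fowler_origin v (Q i) = v"

definition fowler_sign :: "'a sgraph \<Rightarrow> 'a \<Rightarrow> 'a fowler_vertex set \<Rightarrow> real" where
  "fowler_sign \<Gamma> v e = (if \<exists>i. Q i \<in> e then 1 else sign \<Gamma> (fowler_origin v ` e))"

text \<open>The argument \<open>u\<close> enumerates the neighbours of \<open>v\<close> as \<open>u 1, \<dots>, u (vdegree \<Gamma> v)\<close>.\<close>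

definition fowler :: "'a sgraph \<Rightarrow> 'a \<Rightarrow> (nat \<Rightarrow> 'a) \<Rightarrow> 'a fowler_vertex sgraph" where
  "fowler \<Gamma> v u = (let I = {1..vdegree \<Gamma> v} in
     \<lparr> verts = Old ` verts \<Gamma> \<union> Q ` I \<union> P ` I,
       edges = (\<lambda>e. Old ` e) ` (edges \<Gamma> - {{v, u i} | i. i \<in> I}) \<union>
               {{Q i, P j} | i j. i \<in> I \<and> j \<in> I \<and> i \<noteq> j} \<union>
               {{Old v, Q i} | i. i \<in> I} \<union>
               {{P i, Old (u i)} | i. i \<in> I},
       sign = fowler_sign \<Gamma> v \<rparr>)"

lemma fowler_sign_simps:
  "fowler_sign \<Gamma> v {Old v, Q i} = 1"
  "fowler_sign \<Gamma> v {Q i, P j} = 1"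
  "fowler_sign \<Gamma> v {P i, Old (u i)} = sign \<Gamma> {v, u i}"
  "fowler_sign \<Gamma> v (Old ` e) = sign \<Gamma> e"
  by (auto simp: fowler_sign_def image_image)

lemma signed_graph_fowler:
  assumes "signed_graph \<Gamma>" "v \<in> verts \<Gamma>" "bij_betw u {1..vdegree \<Gamma> v} (neighbours \<Gamma> v)"
  shows "signed_graph (fowler \<Gamma> v u)"
proof -
  have u: "{v, u i} \<in> edges \<Gamma>" "u i \<in> verts \<Gamma>" if "i \<in> {1..vdegree \<Gamma> v}" for i
  proof -
    show e: "{v, u i} \<in> edges \<Gamma>"
      using bij_betwE[OF assms(3)] that by (auto simp: neighbours_def)
    show "u i \<in> verts \<Gamma>" using assms(1) e by (auto simp: signed_graph_def)
  qed
  have fin: "finite (verts (fowler \<Gamma> v u))"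
    using assms(1) by (simp add: fowler_def signed_graph_def Let_def)
  have "e \<subseteq> verts (fowler \<Gamma> v u) \<and> card e = 2 \<and> fowler_sign \<Gamma> v e \<in> {-1, 1}"
    if e: "e \<in> edges (fowler \<Gamma> v u)" for e
  proof -
    consider d where "d \<in> edges \<Gamma>" "e = Old ` d"
      | i j where "i \<in> {1..vdegree \<Gamma> v}" "j \<in> {1..vdegree \<Gamma> v}" "e = {Q i, P j}"
      | i where "i \<in> {1..vdegree \<Gamma> v}" "e = {Old v, Q i}"
      | i where "i \<in> {1..vdegree \<Gamma> v}" "e = {P i, Old (u i)}"
      using e unfolding fowler_def Let_def sgraph.simps
      by (elim UnE imageE CollectE exE conjE DiffE) assumption+
    then show ?thesis
    proof cases
      case 1
      then have "d \<subseteq> verts \<Gamma>" using assms(1) by (simp add: signed_graph_def)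
      then have "Old ` d \<subseteq> Old ` verts \<Gamma>" by (rule image_mono)
      with 1 show ?thesis using assms(1)
        by (auto simp: fowler_def Let_def signed_graph_def fowler_sign_simps card_image inj_on_def)
    next
      case 2
      then show ?thesis by (auto simp: fowler_def Let_def fowler_sign_simps)
    next
      case 3
      then show ?thesis using assms(2) by (auto simp: fowler_def Let_def fowler_sign_simps)
    next
      case 4
      then show ?thesis using u[OF 4(1)] assms(1)
        by (auto simp: fowler_def Let_def fowler_sign_simps signed_graph_def)
    qed
  qed
  then show ?thesis using fin by (auto simp: signed_graph_def fowler_def Let_def)
qed

end

theory Submission
  imports Defs
begin

text \<open>
  Write \<open>\<rho>\<close> for the degree of \<open>v\<close>, \<open>u\<^sub>i\<close> for its neighbours and \<open>\<sigma>\<^sub>i\<close> for the sign of \<open>vu\<^sub>i\<close>. A vector \<open>z\<close> lies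
  in the kernel of the Fowler graph iff it satisfies four kinds of local equations:

  \<^item> at \<open>v\<close>: the sum of all \<open>z(q\<^sub>i)\<close> is \<open>0\<close>;
  \<^item> at \<open>q\<^sub>i\<close>: \<open>z(v)\<close> plus the sum of the \<open>z(p\<^sub>j)\<close> with \<open>j \<noteq> i\<close> is \<open>0\<close>;
  \<^item> at \<open>p\<^sub>i\<close>: \<open>\<sigma>\<^sub>i z(u\<^sub>i)\<close> plus the sum of the \<open>z(q\<^sub>j)\<close> with \<open>j \<noteq> i\<close> is \<open>0\<close>;
  \<^item> at an old vertex \<open>a \<noteq> v\<close>: the old equation, in which \<open>z(p\<^sub>i)\<close> replaces the value at \<open>v\<close>
    if \<open>a = u\<^sub>i\<close>.

  The equations at the \<open>q\<^sub>i\<close> force all \<open>z(p\<^sub>i)\<close> to have a common value \<open>c\<close> with \<open>z(v) = (1 - \<rho>) c\<close>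
  (if \<open>\<rho> = 0\<close>, put \<open>c = z(v)\<close>), and those at \<open>v\<close> and the \<open>p\<^sub>i\<close> force \<open>z(q\<^sub>i) = \<sigma>\<^sub>i z(u\<^sub>i)\<close>. What remains are exactly the equations of the
  original graph for the vector \<open>y\<close> that agrees with \<open>z\<close> off \<open>v\<close> and has \<open>y(v) = c\<close>. Hence the
  injective linear map \<open>fowler_lift\<close> that sends \<open>y\<close> to \<open>z\<close> carries one kernel onto the other
  (\<open>fowler_lift_kernel\<close>), and the nullities agree.

  The entries of \<open>z\<close> are those of \<open>y\<close> up to signs, except for \<open>z(v) = (1 - \<rho>) y(v)\<close>. So fullness
  is preserved in both directions unless \<open>\<rho> = 1\<close>. In that case neither kernel contains a full
  vector: a pendant vertex forces the value at its neighbour to vanish, and \<open>z(v) = 0\<close>.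
\<close>

section \<open>Linear images and finitely supported functions\<close>

text \<open>The type of finitely supported functions need not be finite-dimensional, so the dimension is
  transported by mapping a basis.\<close>

lemma dim_inj_linear_image:
  fixes f :: "'a::real_vector \<Rightarrow> 'b::real_vector"
  assumes f: "linear f" and inj: "inj f"
  shows "dim (f ` V) = dim V"
proof -
  obtain B where B: "B \<subseteq> V" "independent B" "V \<subseteq> span B"
    using maximal_independent_subset by blast
  have spanB: "span B = span V"
    using B by (metis span_mono span_span subset_antisym)
  have "span (f ` B) = span (f ` V)"
    using f spanB by (simp add: linear_span_image)
  moreover have "independent (f ` B)"
    using f B(2) inj by (meson inj_on_subset linear_independent_injective_image subset_UNIV)
  ultimately have "dim (f ` V) = card (f ` B)"
    by (metis dim_eq_card)
  also have "\<dots> = card B"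
    using inj by (meson card_image inj_on_subset subset_UNIV)
  also have "\<dots> = dim V"
    using spanB B(2) by (metis dim_eq_card)
  finally show ?thesis .
qed

lemma lookup_scaleR:
  fixes x :: "'a \<Rightarrow>\<^sub>0 real"
  shows "Poly_Mapping.lookup (c *\<^sub>R x) b = c * Poly_Mapping.lookup x b"
proof -
  have "finite {i. c * Poly_Mapping.lookup x i \<noteq> 0}"
    by (rule finite_subset[OF _ finite_keys[of x]]) (auto simp: in_keys_iff)
  then show ?thesis by (simp add: scaleR_poly_mapping_def)
qed

section \<open>The equations that define the two kernels\<close>

lemma adjacency_commute: "adjacency \<Gamma> a b = adjacency \<Gamma> b a"
  by (simp add: adjacency_def insert_commute)

locale fowler_construction =
  fixes \<Gamma> :: "'a sgraph" and v :: 'a and u :: "nat \<Rightarrow> 'a"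
  assumes graph: "signed_graph \<Gamma>"
    and v_vertex: "v \<in> verts \<Gamma>"
    and enum: "bij_betw u {1..vdegree \<Gamma> v} (neighbours \<Gamma> v)"
begin

abbreviation "I \<equiv> {1..vdegree \<Gamma> v}"

lemma finite_verts: "finite (verts \<Gamma>)"
  using graph by (simp add: signed_graph_def)

lemma no_loop: "{a, a} \<notin> edges \<Gamma>"
  using graph by (auto simp: signed_graph_def)

lemma edge_u: "i \<in> I \<Longrightarrow> {v, u i} \<in> edges \<Gamma>"
  using bij_betwE[OF enum] by (auto simp: neighbours_def)

lemma u_vertex: "i \<in> I \<Longrightarrow> u i \<in> verts \<Gamma>"
  using edge_u[of i] graph by (auto simp: signed_graph_def)

lemma u_neq_v: "i \<in> I \<Longrightarrow> u i \<noteq> v"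
  using edge_u no_loop by metis

lemma u_eq_iff: "i \<in> I \<Longrightarrow> j \<in> I \<Longrightarrow> u i = u j \<longleftrightarrow> i = j"
  using enum by (metis bij_betw_imp_inj_on inj_on_eq_iff)

lemma edge_v_iff: "{v, w} \<in> edges \<Gamma> \<longleftrightarrow> (\<exists>i\<in>I. w = u i)"
  using enum by (auto simp: bij_betw_def neighbours_def)

lemma adjacency_loop: "adjacency \<Gamma> a a = 0"
  using no_loop by (simp add: adjacency_def)

lemma adjacency_u_sign: "i \<in> I \<Longrightarrow> adjacency \<Gamma> v (u i) \<in> {-1, 1}"
  using edge_u[of i] graph by (auto simp: adjacency_def signed_graph_def)

abbreviation "F \<equiv> fowler \<Gamma> v u"

lemma verts_fowler: "verts F = Old ` verts \<Gamma> \<union> Q ` I \<union> P ` I"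
  by (simp add: fowler_def Let_def)

lemma edges_fowler:
  "{Old a, Old b} \<in> edges F \<longleftrightarrow> {a, b} \<in> edges \<Gamma> \<and> a \<noteq> v \<and> b \<noteq> v"
  "{Old a, Q i} \<in> edges F \<longleftrightarrow> a = v \<and> i \<in> I"
  "{Old a, P i} \<in> edges F \<longleftrightarrow> i \<in> I \<and> a = u i"
  "{Q i, P j} \<in> edges F \<longleftrightarrow> i \<in> I \<and> j \<in> I \<and> i \<noteq> j"
  "{Q i, Q j} \<notin> edges F"
  "{P i, P j} \<notin> edges F"
proof -
  have inj: "Old ` e = {Old a, Old b} \<longleftrightarrow> e = {a, b}" for e and a b :: 'a
    using inj_image_eq_iff[of Old e "{a, b}"] by (auto simp: inj_def)
  have mem: "{Old a, Old b} \<in> (\<lambda>e. Old ` e) ` E \<longleftrightarrow> {a, b} \<in> E" for a b :: 'a and E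
    using inj by (metis (no_types, lifting) image_iff)
  have rem: "{a, b} \<in> {{v, u i} | i. i \<in> I} \<longleftrightarrow> {a, b} \<in> edges \<Gamma> \<and> (a = v \<or> b = v)" for a b
    using edge_v_iff[of a] edge_v_iff[of b] edge_u
    by (auto simp: doubleton_eq_iff insert_commute)
  have "{Old a, Old b} \<in> edges F \<longleftrightarrow> {Old a, Old b} \<in> (\<lambda>e. Old ` e) ` (edges \<Gamma> - {{v, u i} | i. i \<in> I})"
    by (auto simp: fowler_def Let_def doubleton_eq_iff)
  then show "{Old a, Old b} \<in> edges F \<longleftrightarrow> {a, b} \<in> edges \<Gamma> \<and> a \<noteq> v \<and> b \<noteq> v"
    unfolding mem Diff_iff rem by blast
  have nQ: "Q i \<in> e \<Longrightarrow> e \<notin> (\<lambda>e. Old ` e) ` E" and nP: "P i \<in> e \<Longrightarrow> e \<notin> (\<lambda>e. Old ` e) ` E"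
    for i e and E :: "'a set set" by auto
  show "{Old a, Q i} \<in> edges F \<longleftrightarrow> a = v \<and> i \<in> I"
    "{Old a, P i} \<in> edges F \<longleftrightarrow> i \<in> I \<and> a = u i"
    "{Q i, P j} \<in> edges F \<longleftrightarrow> i \<in> I \<and> j \<in> I \<and> i \<noteq> j"
    "{Q i, Q j} \<notin> edges F"
    "{P i, P j} \<notin> edges F"
    by (auto simp: fowler_def Let_def doubleton_eq_iff nQ nP)
qed

lemma sign_fowler: "sign F = fowler_sign \<Gamma> v"
  by (simp add: fowler_def Let_def)

lemma adjacency_fowler:
  "adjacency F (Old a) (Old b) = (if a = v \<or> b = v then 0 else adjacency \<Gamma> a b)"
  "adjacency F (Old a) (Q i) = (if a = v \<and> i \<in> I then 1 else 0)"
  "adjacency F (Old a) (P i) = (if i \<in> I \<and> a = u i then adjacency \<Gamma> a v else 0)"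
  "adjacency F (Q i) (P j) = (if i \<in> I \<and> j \<in> I \<and> i \<noteq> j then 1 else 0)"
  "adjacency F (Q i) (Q j) = 0"
  "adjacency F (P i) (P j) = 0"
  using edge_u
  by (auto simp: adjacency_def edges_fowler sign_fowler fowler_sign_def insert_commute[of v])

lemma adjacency_fowler_flipped:
  "adjacency F (Q i) (Old a) = (if a = v \<and> i \<in> I then 1 else 0)"
  "adjacency F (P i) (Old a) = (if i \<in> I \<and> a = u i then adjacency \<Gamma> a v else 0)"
  "adjacency F (P j) (Q i) = (if i \<in> I \<and> j \<in> I \<and> i \<noteq> j then 1 else 0)"
  by (simp_all add: adjacency_commute[of F "Q i" "Old a"] adjacency_commute[of F "P i" "Old a"]
      adjacency_commute[of F "P j" "Q i"] adjacency_fowler)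

lemma sum_verts_fowler:
  "(\<Sum>b\<in>verts F. g b) = (\<Sum>b\<in>verts \<Gamma>. g (Old b)) + (\<Sum>i\<in>I. g (Q i)) + (\<Sum>i\<in>I. g (P i))"
proof -
  have "(\<Sum>b\<in>verts F. g b) = sum g (Old ` verts \<Gamma>) + sum g (Q ` I) + sum g (P ` I)"
    unfolding verts_fowler using finite_verts
    by (subst sum.union_disjoint, simp, simp, blast)+ (rule refl)
  then show ?thesis
    by (simp add: sum.reindex inj_on_def)
qed

lemma sum_others: "(\<Sum>j\<in>I. (if i \<noteq> j then 1 else 0) * h j) = (\<Sum>j\<in>I. h j) - (h i :: real)"
  if "i \<in> I"
proof -
  have "(\<Sum>j\<in>I. (if i \<noteq> j then 1 else 0) * h j) = (\<Sum>j\<in>I. h j - (if i = j then h j else 0))"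
    by (intro sum.cong) auto
  with that show ?thesis by (simp add: sum_subtractf)
qed

lemma fowler_row_v:
  "(\<Sum>b\<in>verts F. adjacency F (Old v) b * z b) = (\<Sum>i\<in>I. z (Q i))"
proof -
  have "(\<Sum>i\<in>I. adjacency F (Old v) (P i) * z (P i)) = 0"
    by (intro sum.neutral) (auto simp: adjacency_fowler adjacency_loop)
  then show ?thesis
    by (simp add: sum_verts_fowler adjacency_fowler)
qed

lemma fowler_row_Q:
  assumes "i \<in> I"
  shows "(\<Sum>b\<in>verts F. adjacency F (Q i) b * z b) = z (Old v) + ((\<Sum>j\<in>I. z (P j)) - z (P i))"
proof -
  have "(\<Sum>a\<in>verts \<Gamma>. adjacency F (Q i) (Old a) * z (Old a)) =
      (\<Sum>a\<in>verts \<Gamma>. if a = v then z (Old a) else 0)"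
    using assms by (intro sum.cong) (auto simp: adjacency_fowler_flipped)
  also have "\<dots> = z (Old v)"
    using finite_verts v_vertex by simp
  finally show ?thesis
    using assms sum_others[OF assms, of "\<lambda>j. z (P j)"]
    by (simp add: sum_verts_fowler adjacency_fowler)
qed

lemma fowler_row_P:
  assumes "i \<in> I"
  shows "(\<Sum>b\<in>verts F. adjacency F (P i) b * z b) =
    adjacency \<Gamma> v (u i) * z (Old (u i)) + ((\<Sum>j\<in>I. z (Q j)) - z (Q i))"
proof -
  have "(\<Sum>a\<in>verts \<Gamma>. adjacency F (P i) (Old a) * z (Old a)) =
      (\<Sum>a\<in>verts \<Gamma>. if a = u i then adjacency \<Gamma> a v * z (Old a) else 0)"
    using assms by (intro sum.cong) (auto simp: adjacency_fowler_flipped)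
  also have "\<dots> = adjacency \<Gamma> v (u i) * z (Old (u i))"
    using finite_verts u_vertex[OF assms] by (simp add: adjacency_commute[of \<Gamma> v])
  finally have old: "(\<Sum>a\<in>verts \<Gamma>. adjacency F (P i) (Old a) * z (Old a)) =
      adjacency \<Gamma> v (u i) * z (Old (u i))" .
  have "(\<Sum>j\<in>I. adjacency F (P i) (Q j) * z (Q j)) = (\<Sum>j\<in>I. (if i \<noteq> j then 1 else 0) * z (Q j))"
    using assms by (intro sum.cong) (auto simp: adjacency_fowler_flipped)
  then show ?thesis
    using old sum_others[OF assms, of "\<lambda>j. z (Q j)"]
    by (simp add: sum_verts_fowler adjacency_fowler)
qed

text \<open>If \<open>a\<close> is the neighbour \<open>u i\<close>, its edge to \<open>v\<close> has been redirected to \<open>P i\<close>. So a common value \<open>c\<close>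
  at all the \<open>P i\<close>, which the equations at the \<open>Q i\<close> force on kernel vectors, acts on the old
  vertices like the value \<open>c\<close> at \<open>v\<close> in the original graph.\<close>

lemma fowler_row_Old:
  assumes "a \<noteq> v" and c: "\<And>i. i \<in> I \<Longrightarrow> z (P i) = c"
  shows "(\<Sum>b\<in>verts F. adjacency F (Old a) b * z b) =
    (\<Sum>b\<in>verts \<Gamma> - {v}. adjacency \<Gamma> a b * z (Old b)) + adjacency \<Gamma> a v * c"
proof -
  have "(\<Sum>b\<in>verts \<Gamma>. adjacency F (Old a) (Old b) * z (Old b)) =
      (\<Sum>b\<in>verts \<Gamma> - {v}. adjacency F (Old a) (Old b) * z (Old b))"
    using finite_verts by (intro sum.mono_neutral_right) (auto simp: adjacency_fowler)
  also have "\<dots> = (\<Sum>b\<in>verts \<Gamma> - {v}. adjacency \<Gamma> a b * z (Old b))"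
    using assms(1) by (intro sum.cong) (auto simp: adjacency_fowler)
  finally have old: "(\<Sum>b\<in>verts \<Gamma>. adjacency F (Old a) (Old b) * z (Old b)) =
      (\<Sum>b\<in>verts \<Gamma> - {v}. adjacency \<Gamma> a b * z (Old b))" .
  have new: "(\<Sum>i\<in>I. adjacency F (Old a) (P i) * z (P i)) = adjacency \<Gamma> a v * c"
  proof (cases "\<exists>k\<in>I. a = u k")
    case True
    then obtain k where k: "k \<in> I" "a = u k" by blast
    have "(\<Sum>i\<in>I. adjacency F (Old a) (P i) * z (P i)) =
        (\<Sum>i\<in>I. if i = k then adjacency \<Gamma> a v * c else 0)"
      using k u_eq_iff c by (intro sum.cong) (auto simp: adjacency_fowler)
    with k show ?thesis by simp
  next
    case False
    then have "adjacency \<Gamma> a v = 0"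
      using edge_v_iff[of a] by (simp add: adjacency_def insert_commute)
    moreover have "(\<Sum>i\<in>I. adjacency F (Old a) (P i) * z (P i)) = 0"
      using False by (intro sum.neutral) (auto simp: adjacency_fowler)
    ultimately show ?thesis by simp
  qed
  have "(\<Sum>i\<in>I. adjacency F (Old a) (Q i) * z (Q i)) = 0"
    using assms(1) by (simp add: adjacency_fowler)
  with old new show ?thesis
    by (simp add: sum_verts_fowler)
qed

lemma row_v:
  "(\<Sum>b\<in>verts \<Gamma>. adjacency \<Gamma> v b * y b) = (\<Sum>i\<in>I. adjacency \<Gamma> v (u i) * y (u i))"
proof -
  have sub: "neighbours \<Gamma> v \<subseteq> verts \<Gamma>"
    using graph by (auto simp: signed_graph_def neighbours_def)
  have "(\<Sum>b\<in>verts \<Gamma>. adjacency \<Gamma> v b * y b) = (\<Sum>b\<in>neighbours \<Gamma> v. adjacency \<Gamma> v b * y b)"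
    using finite_verts sub
    by (intro sum.mono_neutral_right) (auto simp: neighbours_def adjacency_def)
  also have "\<dots> = (\<Sum>i\<in>I. adjacency \<Gamma> v (u i) * y (u i))"
    using enum by (rule sum.reindex_bij_betw[symmetric])
  finally show ?thesis .
qed

lemma row_split:
  "(\<Sum>b\<in>verts \<Gamma>. adjacency \<Gamma> a b * y b) =
    (\<Sum>b\<in>verts \<Gamma> - {v}. adjacency \<Gamma> a b * y b) + adjacency \<Gamma> a v * y v"
  using finite_verts v_vertex by (simp add: sum.remove)

section \<open>The isomorphism of the kernels\<close>

text \<open>The values at \<open>Old v\<close> and \<open>Q i\<close> are those that the kernel equations dictate once
  \<open>y v\<close> has been moved to all the \<open>P i\<close>.\<close>

fun lift_entry :: "('a \<Rightarrow>\<^sub>0 real) \<Rightarrow> 'a fowler_vertex \<Rightarrow> real" where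
  "lift_entry y (Old w) =
     (if w = v then 1 - real (vdegree \<Gamma> v) else 1) * Poly_Mapping.lookup y w"
| "lift_entry y (Q i) = (if i \<in> I then adjacency \<Gamma> v (u i) * Poly_Mapping.lookup y (u i) else 0)"
| "lift_entry y (P i) = (if i \<in> I then Poly_Mapping.lookup y v else 0)"

definition fowler_lift :: "('a \<Rightarrow>\<^sub>0 real) \<Rightarrow> ('a fowler_vertex \<Rightarrow>\<^sub>0 real)" where
  "fowler_lift y = Abs_poly_mapping (lift_entry y)"

lemma lookup_fowler_lift: "Poly_Mapping.lookup (fowler_lift y) = lift_entry y"
proof -
  have "x \<in> Old ` Poly_Mapping.keys y \<union> Q ` I \<union> P ` I" if "lift_entry y x \<noteq> 0" for x
    using that by (cases x) (auto simp: in_keys_iff split: if_splits)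
  then have "{x. lift_entry y x \<noteq> 0} \<subseteq> Old ` Poly_Mapping.keys y \<union> Q ` I \<union> P ` I"
    by blast
  then have "finite {x. lift_entry y x \<noteq> 0}"
    by (rule finite_subset) simp
  then show ?thesis
    by (simp add: fowler_lift_def)
qed

lemma linear_fowler_lift: "linear fowler_lift"
proof (rule linearI)
  fix x y :: "'a \<Rightarrow>\<^sub>0 real" and c :: real
  show "fowler_lift (x + y) = fowler_lift x + fowler_lift y"
  proof (rule poly_mapping_eqI)
    fix k show "Poly_Mapping.lookup (fowler_lift (x + y)) k =
        Poly_Mapping.lookup (fowler_lift x + fowler_lift y) k"
      by (cases k) (auto simp: lookup_fowler_lift lookup_add algebra_simps)
  qed
  show "fowler_lift (c *\<^sub>R x) = c *\<^sub>R fowler_lift x"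
  proof (rule poly_mapping_eqI)
    fix k show "Poly_Mapping.lookup (fowler_lift (c *\<^sub>R x)) k =
        Poly_Mapping.lookup (c *\<^sub>R fowler_lift x) k"
      by (cases k) (auto simp: lookup_fowler_lift lookup_scaleR algebra_simps)
  qed
qed

text \<open>The entry at \<open>v\<close> is read off at \<open>P 1\<close>, because the factor \<open>1 - \<rho>\<close> vanishes for \<open>\<rho> = 1\<close>;
  if there is no \<open>P 1\<close>, that is \<open>\<rho> = 0\<close>, the factor is \<open>1\<close>.\<close>

lemma inj_fowler_lift: "inj fowler_lift"
proof (rule injI)
  fix x y assume "fowler_lift x = fowler_lift y"
  then have eq: "lift_entry x k = lift_entry y k" for k
    by (metis lookup_fowler_lift)
  show "x = y"
  proof (rule poly_mapping_eqI)
    fix w show "Poly_Mapping.lookup x w = Poly_Mapping.lookup y w"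
      using eq[of "Old w"] eq[of "P 1"]
      by (cases "w = v"; cases "vdegree \<Gamma> v = 0") auto
  qed
qed

lemma fowler_lift_in_kernel:
  assumes "y \<in> adj_kernel \<Gamma>"
  shows "fowler_lift y \<in> adj_kernel F"
proof -
  let ?y = "Poly_Mapping.lookup y" and ?z = "lift_entry y"
  have keys: "Poly_Mapping.keys y \<subseteq> verts \<Gamma>"
    and rows: "\<And>a. a \<in> verts \<Gamma> \<Longrightarrow> (\<Sum>b\<in>verts \<Gamma>. adjacency \<Gamma> a b * ?y b) = 0"
    using assms by (auto simp: adj_kernel_def)
  have "x \<in> verts F" if "?z x \<noteq> 0" for x
    using that keys by (cases x) (auto simp: verts_fowler in_keys_iff split: if_splits)
  then have "Poly_Mapping.keys (fowler_lift y) \<subseteq> verts F"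
    by (auto simp: in_keys_iff lookup_fowler_lift)
  moreover have "(\<Sum>b\<in>verts F. adjacency F a b * ?z b) = 0" if a: "a \<in> verts F" for a
  proof -
    have sumQ: "(\<Sum>i\<in>I. ?z (Q i)) = 0"
      using rows[OF v_vertex] by (simp add: row_v)
    consider "a = Old v" | w where "a = Old w" "w \<in> verts \<Gamma>" "w \<noteq> v"
      | i where "a = Q i" "i \<in> I" | i where "a = P i" "i \<in> I"
      using a by (auto simp: verts_fowler)
    then show ?thesis
    proof cases
      case 1
      with sumQ show ?thesis by (simp add: fowler_row_v del: lift_entry.simps)
    next
      case 2
      have "(\<Sum>b\<in>verts F. adjacency F (Old w) b * ?z b) =
          (\<Sum>b\<in>verts \<Gamma> - {v}. adjacency \<Gamma> w b * ?z (Old b)) + adjacency \<Gamma> w v * ?y v"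
        using 2 by (intro fowler_row_Old) auto
      also have "\<dots> = (\<Sum>b\<in>verts \<Gamma>. adjacency \<Gamma> w b * ?y b)"
        unfolding row_split by simp
      finally show ?thesis using 2 rows by simp
    next
      case 3
      then show ?thesis
        unfolding \<open>a = Q i\<close> fowler_row_Q[OF 3(2)] by (simp add: algebra_simps)
    next
      case 4
      then show ?thesis
        unfolding \<open>a = P i\<close> fowler_row_P[OF 4(2)] sumQ using u_neq_v[of i] by simp
    qed
  qed
  ultimately show ?thesis
    by (simp add: adj_kernel_def lookup_fowler_lift)
qed

text \<open>Conversely, the equations at \<open>Old v\<close>, the \<open>Q i\<close> and the \<open>P i\<close> leave no freedom in the entries
  that the construction adds, so that every kernel vector is a lift.\<close>

lemma kernel_vector_is_fowler_lift:
  assumes z: "z \<in> adj_kernel F"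
  obtains y where "y \<in> adj_kernel \<Gamma>" "z = fowler_lift y"
proof -
  let ?z = "Poly_Mapping.lookup z" and ?\<rho> = "vdegree \<Gamma> v"
  have rows: "\<And>a. a \<in> verts F \<Longrightarrow> (\<Sum>b\<in>verts F. adjacency F a b * ?z b) = 0"
    using z by (auto simp: adj_kernel_def)
  have supp: "?z x = 0" if "x \<notin> verts F" for x
    using z that by (auto simp: adj_kernel_def in_keys_iff)
  have supp_new: "?z (Q i) = 0" "?z (P i) = 0" if "i \<notin> I" for i
    using that by (auto intro!: supp simp: verts_fowler)
  have eq_v: "(\<Sum>i\<in>I. ?z (Q i)) = 0"
    unfolding fowler_row_v[symmetric] using v_vertex by (intro rows) (simp add: verts_fowler)
  have eq_Q: "?z (P i) = ?z (Old v) + (\<Sum>j\<in>I. ?z (P j))" if "i \<in> I" for i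
  proof -
    have "Q i \<in> verts F" using that by (simp add: verts_fowler)
    from rows[OF this] show ?thesis
      unfolding fowler_row_Q[OF that] by simp
  qed
  have zQ: "?z (Q i) = adjacency \<Gamma> v (u i) * ?z (Old (u i))" if "i \<in> I" for i
  proof -
    have "P i \<in> verts F" using that by (simp add: verts_fowler)
    from rows[OF this] show ?thesis
      unfolding fowler_row_P[OF that] using eq_v by simp
  qed
  \<comment> \<open>For \<open>\<rho> = 0\<close> the sum is empty and \<open>c = z(v)\<close>, which is again the value required at \<open>v\<close>.\<close>
  define c where "c = ?z (Old v) + (\<Sum>j\<in>I. ?z (P j))"
  have zP: "?z (P i) = c" if "i \<in> I" for i
    using eq_Q[OF that] by (simp add: c_def)
  have zv: "?z (Old v) = (1 - real ?\<rho>) * c"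
  proof -
    have "(\<Sum>j\<in>I. ?z (P j)) = real ?\<rho> * c"
      using zP by simp
    then show ?thesis
      using c_def by (simp add: algebra_simps)
  qed
  define f where "f w = (if w \<in> verts \<Gamma> then if w = v then c else ?z (Old w) else 0)" for w
  define y where "y = Abs_poly_mapping f"
  have f: "Poly_Mapping.lookup y = f"
    unfolding y_def using finite_verts
    by (intro Abs_poly_mapping_inverse) (auto simp: f_def elim!: rev_finite_subset)
  have "Poly_Mapping.keys y \<subseteq> verts \<Gamma>"
    by (auto simp: in_keys_iff f f_def split: if_splits)
  moreover have "(\<Sum>b\<in>verts \<Gamma>. adjacency \<Gamma> a b * f b) = 0" if a: "a \<in> verts \<Gamma>" for a
  proof (cases "a = v")
    case True
    have "(\<Sum>i\<in>I. adjacency \<Gamma> v (u i) * f (u i)) = (\<Sum>i\<in>I. ?z (Q i))"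
      using zQ u_vertex u_neq_v by (intro sum.cong) (auto simp: f_def)
    with True eq_v show ?thesis by (simp add: row_v)
  next
    case False
    have "(\<Sum>b\<in>verts \<Gamma>. adjacency \<Gamma> a b * f b) =
        (\<Sum>b\<in>verts \<Gamma> - {v}. adjacency \<Gamma> a b * ?z (Old b)) + adjacency \<Gamma> a v * c"
      unfolding row_split using v_vertex by (simp add: f_def)
    also have "\<dots> = (\<Sum>b\<in>verts F. adjacency F (Old a) b * ?z b)"
      using False zP by (intro fowler_row_Old[symmetric]) auto
    also have "\<dots> = 0"
      using a by (intro rows) (simp add: verts_fowler)
    finally show ?thesis .
  qed
  ultimately have "y \<in> adj_kernel \<Gamma>"
    by (simp add: adj_kernel_def f)
  moreover have "z = fowler_lift y"
  proof (rule poly_mapping_eqI)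
    fix k show "?z k = Poly_Mapping.lookup (fowler_lift y) k"
    proof (cases k)
      case (Old w)
      then show ?thesis
        using supp[of k] zv v_vertex
        by (auto simp: lookup_fowler_lift f f_def verts_fowler)
    next
      case (Q i)
      then show ?thesis
        using supp_new[of i] zQ[of i] u_vertex[of i] u_neq_v[of i]
        by (cases "i \<in> I") (auto simp: lookup_fowler_lift f f_def)
    next
      case (P i)
      then show ?thesis
        using supp_new[of i] zP[of i] v_vertex
        by (cases "i \<in> I") (auto simp: lookup_fowler_lift f f_def)
    qed
  qed
  ultimately show thesis by (rule that)
qed

lemma fowler_lift_kernel: "fowler_lift ` adj_kernel \<Gamma> = adj_kernel F"
  using fowler_lift_in_kernel kernel_vector_is_fowler_lift by blast

section \<open>Full kernel vectors\<close>

text \<open>If \<open>v\<close> is pendant, its own equation says that the entry at its only neighbour is zero.\<close>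

lemma full_kernel_vector_degree:
  assumes "y \<in> adj_kernel \<Gamma>" "full \<Gamma> y"
  shows "vdegree \<Gamma> v \<noteq> 1"
proof
  assume deg: "vdegree \<Gamma> v = 1"
  have "(\<Sum>b\<in>verts \<Gamma>. adjacency \<Gamma> v b * Poly_Mapping.lookup y b) = 0"
    using assms(1) v_vertex by (simp add: adj_kernel_def)
  then have "adjacency \<Gamma> v (u 1) * Poly_Mapping.lookup y (u 1) = 0"
    by (simp add: row_v deg)
  then show False
    using adjacency_u_sign[of 1] u_vertex[of 1] assms(2) deg by (auto simp: full_def)
qed

lemma full_fowler_lift_iff:
  assumes "y \<in> adj_kernel \<Gamma>"
  shows "full F (fowler_lift y) \<longleftrightarrow> full \<Gamma> y"
proof
  assume full: "full F (fowler_lift y)"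
  show "full \<Gamma> y"
    unfolding full_def
  proof
    fix w assume "w \<in> verts \<Gamma>"
    then have "Old w \<in> verts F" by (simp add: verts_fowler)
    with full have "lift_entry y (Old w) \<noteq> 0"
      unfolding full_def lookup_fowler_lift by blast
    then show "Poly_Mapping.lookup y w \<noteq> 0" by auto
  qed
next
  assume full: "full \<Gamma> y"
  have "vdegree \<Gamma> v \<noteq> 1"
    using full_kernel_vector_degree assms full by blast
  moreover have "adjacency \<Gamma> v (u i) \<noteq> 0" if "i \<in> I" for i
    using adjacency_u_sign[OF that] by auto
  ultimately show "full F (fowler_lift y)"
    using full v_vertex u_vertex
    by (auto simp: full_def lookup_fowler_lift verts_fowler split: if_splits)
qed

lemma nullity_fowler: "nullity F = nullity \<Gamma>"
  unfolding nullity_def fowler_lift_kernel[symmetric]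
  using linear_fowler_lift inj_fowler_lift by (rule dim_inj_linear_image)

lemma kernel_has_full_eigenvector_fowler:
  "kernel_has_full_eigenvector F \<longleftrightarrow> kernel_has_full_eigenvector \<Gamma>"
proof -
  have "x \<noteq> 0" if "full \<Gamma> x" for x
    using that v_vertex by (auto simp: full_def)
  moreover have "x \<noteq> 0" if "full F x" for x
    using that v_vertex by (auto simp: full_def verts_fowler)
  ultimately show ?thesis
    unfolding kernel_has_full_eigenvector_def fowler_lift_kernel[symmetric]
    using full_fowler_lift_iff by blast
qed

end

theorem theorem18:
  fixes \<Gamma> :: "'a sgraph" and v :: 'a and u :: "nat \<Rightarrow> 'a"
  assumes "signed_graph \<Gamma>"
    and "v \<in> verts \<Gamma>"
    and "bij_betw u {1..vdegree \<Gamma> v} (neighbours \<Gamma> v)"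
  shows "nullity \<Gamma> = nullity (fowler \<Gamma> v u) \<and>
    (kernel_has_full_eigenvector \<Gamma> \<longleftrightarrow> kernel_has_full_eigenvector (fowler \<Gamma> v u))"
proof -
  interpret fowler_construction \<Gamma> v u
    using assms by unfold_locales
  show ?thesis
    using nullity_fowler kernel_has_full_eigenvector_fowler by simp
qed

end
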